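(* Let $d\ge1$ and let $f:[0,\infty)\times\mathbb{R}^d\to\mathbb{R}$ be such that $f(t,\cdot)$ is $\mathcal{C}^1$ for every $t\ge 0$ and the gradient $\nabla f(t,q)$ with respect to $q$ is jointly continuous in $(t,q)$. Suppose that $m>0$, $\sigma>0$, $r>0$ and (finite) $L>m$ satisfy $$r<\sigma,\qquad m\ge 2r\sigma-r^2,\qquad L\le m+4(\sigma-r)\left(\sigma-r+(m-2r\sigma+r^2)^{1/2}\right).$$ If $q\mapsto\nabla f(t,q)$ belongs to the sector $[m,L]$ for all $t\ge0$, then the system $$\dot q=p,\qquad \dot p=-2\sigma p-\nabla f(t,q)$$ on $\mathbb{R}^{2d}\ni z=(q,p)$ is $r$-exponentially stable.
   Context: Sector: for $m<L<\infty$, a continuous function $\phi:\mathbb{R}^n\to\mathbb{R}^n$ belongs to the sector $[m,L]$ if $\langle mw-\phi(w),\,w-L^{-1}\phi(w)\rangle\le 0$ for all $w\in\mathbb{R}^n$. Exponential stability: a system $\dot z=F(t,z)$, $t\ge0$, with $F$ continuous is $r$-exponentially stable ($r\ge0$) if $z=0$ is an equilibrium point and there is an increasing continuous function $\kappa:[0,\infty)\to[0,\infty)$ with $\kappa(0)=0$ such that $|z(t)|\le\kappa(|z(0)|)\,e^{-rt}$ for each solution $z$ (starting at time $0$) and every $t\ge0$ for which $z$ exists. *)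

theory Defs
  imports "HOL-Analysis.Analysis"
begin

text \<open>The gradient is a junk value at points where \<open>f\<close> is not differentiable.\<close>

definition gradient :: "('a::euclidean_space \<Rightarrow> real) \<Rightarrow> 'a \<Rightarrow> 'a" where
  "gradient f x = (THE D. GDERIV f x :> D)"

definition C1_function :: "('a::euclidean_space \<Rightarrow> real) \<Rightarrow> bool" where
  "C1_function f \<longleftrightarrow> (\<forall>x. f differentiable (at x)) \<and> continuous_on UNIV (gradient f)"

definition in_sector :: "real \<Rightarrow> real \<Rightarrow> ('a::euclidean_space \<Rightarrow> 'a) \<Rightarrow> bool" where
  "in_sector m L \<phi> \<longleftrightarrow> continuous_on UNIV \<phi> \<and>
     (\<forall>w. (m *\<^sub>R w - \<phi> w) \<bullet> (w - inverse L *\<^sub>R \<phi> w) \<le> 0)"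

text \<open>
  A solution lives on a nondegenerate interval \<open>I\<close> of \<open>[0,\<infinity>)\<close>, open, closed or
  unbounded on the right, that contains the initial time 0. The derivative is taken
  within \<open>I\<close>, hence is one-sided at 0 (and at the right end point when it belongs to \<open>I\<close>).
\<close>

definition solution_on ::
  "(real \<Rightarrow> 'a::euclidean_space \<Rightarrow> 'a) \<Rightarrow> real set \<Rightarrow> (real \<Rightarrow> 'a) \<Rightarrow> bool" where
  "solution_on F I z \<longleftrightarrow> is_interval I \<and> 0 \<in> I \<and> I \<subseteq> {0..} \<and> I \<noteq> {0} \<and>
     (\<forall>t\<in>I. (z has_vector_derivative F t (z t)) (at t within I))"

definition exponentially_stable ::
  "real \<Rightarrow> (real \<Rightarrow> 'a::euclidean_space \<Rightarrow> 'a) \<Rightarrow> bool" where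
  "exponentially_stable r F \<longleftrightarrow>
     continuous_on ({0..} \<times> UNIV) (\<lambda>(t, z). F t z) \<and>
     (\<forall>t\<ge>0. F t 0 = 0) \<and>
     (\<exists>\<kappa>::real \<Rightarrow> real. \<kappa> \<in> {0..} \<rightarrow> {0..} \<and> continuous_on {0..} \<kappa> \<and>
        strict_mono_on {0..} \<kappa> \<and> \<kappa> 0 = 0 \<and>
        (\<forall>I z. solution_on F I z \<longrightarrow>
           (\<forall>t\<in>I. norm (z t) \<le> \<kappa> (norm (z 0)) * exp (- r * t))))"

end

theory Submission
  imports Defs
begin

text \<open>
  Put \<open>q = exp (- r t) x\<close>, \<open>a = \<sigma> - r\<close> and \<open>k\<^sup>2 = m - 2 r \<sigma> + r\<^sup>2\<close>. The equation becomes
  \<open>x'' + 2 a x' + \<psi> = 0\<close> with \<open>\<psi>\<close> in the sector \<open>[k\<^sup>2, l\<^sup>2]\<close>, \<open>l = k + 2 a\<close>; the bound on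
  \<open>L\<close> says exactly that \<open>l\<^sup>2\<close> is an admissible upper end. For \<open>V = |x' + a x|\<^sup>2 + (a\<^sup>2 + k l) |x|\<^sup>2\<close>
  one computes
  \<open>2 a V' = - |2 a x' + \<psi> - k l x|\<^sup>2 + (\<psi> - k\<^sup>2 x) \<bullet> (\<psi> - l\<^sup>2 x) \<le> 0\<close>,
  so the positive definite form \<open>V\<close> is nonincreasing along solutions.
\<close>

text \<open>Multiplying the defining inequality by \<open>L > 0\<close> clears the inverse. The
  resulting product of two differences is the form that the Lyapunov computation consumes.\<close>

lemma in_sectorD:
  assumes "in_sector m L \<phi>" "L > 0"
  shows "(\<phi> w - m *\<^sub>R w) \<bullet> (\<phi> w - L *\<^sub>R w) \<le> 0"
proof -
  have "(\<phi> w - m *\<^sub>R w) \<bullet> (\<phi> w - L *\<^sub>R w)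
      = L * ((m *\<^sub>R w - \<phi> w) \<bullet> (w - inverse L *\<^sub>R \<phi> w))"
    using assms(2) by (simp add: inner_diff field_simps)
  then show ?thesis
    using assms by (auto simp: in_sector_def mult_le_0_iff)
qed

text \<open>At \<open>w = 0\<close> the sector inequality collapses to
  \<open>\<phi> 0 \<bullet> \<phi> 0 \<le> 0\<close>. This makes the origin an equilibrium.\<close>

lemma in_sector_zero:
  assumes "in_sector m L \<phi>" "L > 0"
  shows "\<phi> 0 = 0"
  using in_sectorD[OF assms, of 0] by (simp add: antisym[OF _ inner_ge_zero] flip: inner_eq_zero_iff)

text \<open>With \<open>u = g - m q\<close>, the hypothesis says
  \<open>u \<bullet> u \<le> (L - m) (u \<bullet> q)\<close>, which forces
  \<open>u \<bullet> q \<ge> 0\<close>; raising the upper end then only weakens the bound. This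
  allows \<open>L\<close> to be replaced by the extreme value for which the dissipation identity is
  exact.\<close>

lemma sector_upper_mono:
  fixes g q :: "'a::real_inner"
  assumes "(g - m *\<^sub>R q) \<bullet> (g - L *\<^sub>R q) \<le> 0" "m < L" "L \<le> M"
  shows "(g - m *\<^sub>R q) \<bullet> (g - M *\<^sub>R q) \<le> 0"
proof -
  define u where "u = g - m *\<^sub>R q"
  have L: "g - L *\<^sub>R q = u - (L - m) *\<^sub>R q" and M: "g - M *\<^sub>R q = u - (M - m) *\<^sub>R q"
    by (simp_all add: u_def algebra_simps)
  have *: "u \<bullet> u \<le> (L - m) * (u \<bullet> q)"
    using assms(1) unfolding L by (simp add: u_def[symmetric] inner_diff)
  then have "0 \<le> (L - m) * (u \<bullet> q)"
    using inner_ge_zero[of u] by linarith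
  then have "0 \<le> u \<bullet> q"
    using assms(2) by (simp add: zero_le_mult_iff)
  then have "(L - m) * (u \<bullet> q) \<le> (M - m) * (u \<bullet> q)"
    using assms(3) by (intro mult_right_mono) auto
  with * show ?thesis
    unfolding M by (simp add: u_def[symmetric] inner_diff)
qed

text \<open>This is the form \<open>V\<close> in the original coordinates, without its factor
  \<open>exp (2 r t)\<close>: since \<open>x' = exp (r t) (p + r q)\<close>, the sum
  \<open>x' + a x\<close> equals \<open>exp (r t) (p + \<sigma> q)\<close>.\<close>

definition lyapunov :: "real \<Rightarrow> real \<Rightarrow> 'a::real_inner \<Rightarrow> 'a \<Rightarrow> real" where
  "lyapunov \<sigma> b q p = (p + \<sigma> *\<^sub>R q) \<bullet> (p + \<sigma> *\<^sub>R q) + b * (q \<bullet> q)"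

text \<open>The left-hand side is the derivative of
  \<open>exp (2 r t) * lyapunov \<sigma> b q p\<close> along the flow, divided by
  \<open>exp (2 r t)\<close>. Stating it pointwise keeps the algebra free of
  differentiation.\<close>

lemma lyapunov_dissipation:
  fixes q p g :: "'a::real_inner"
  assumes "r < \<sigma>"
    and k: "k\<^sup>2 = m - 2 * r * \<sigma> + r\<^sup>2"
    and l: "l = k + 2 * (\<sigma> - r)"
    and b: "b = (\<sigma> - r)\<^sup>2 + k * l"
    and M: "M = m + 4 * (\<sigma> - r) * (\<sigma> - r + k)"
    and sector: "(g - m *\<^sub>R q) \<bullet> (g - M *\<^sub>R q) \<le> 0"
  shows "2 * r * lyapunov \<sigma> b q p
      + 2 * ((p + \<sigma> *\<^sub>R q) \<bullet> (- \<sigma> *\<^sub>R p - g)) + 2 * b * (q \<bullet> p) \<le> 0"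
    (is "?D \<le> 0")
proof -
  define a where "a = \<sigma> - r"
  define y where "y = p + r *\<^sub>R q"
  \<comment> \<open>The substitution \<open>q = exp (- r t) x\<close> adds a linear term with
    coefficient \<open>r\<^sup>2 - 2 r \<sigma> = k\<^sup>2 - m\<close>; absorbing it into the force
    moves the sector from \<open>[m, M]\<close> to \<open>[k\<^sup>2, l\<^sup>2]\<close>.\<close>
  define \<psi> where "\<psi> = g - (m - k\<^sup>2) *\<^sub>R q"
  have m: "m - k\<^sup>2 = 2 * r * \<sigma> - r\<^sup>2"
    using k by simp
  have p: "p = y - r *\<^sub>R q" and g: "g = \<psi> + (2 * r * \<sigma> - r\<^sup>2) *\<^sub>R q" and \<sigma>: "\<sigma> = a + r"
    by (simp_all add: y_def \<psi>_def m[symmetric] a_def)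
  have D: "?D = 2 * (- a * (y \<bullet> y) - y \<bullet> \<psi> - a * (q \<bullet> \<psi>) + k * l * (q \<bullet> y))"
    unfolding lyapunov_def p g \<sigma> b
    by (simp add: inner_add inner_diff inner_commute algebra_simps power2_eq_square)
  have M': "M = m - k\<^sup>2 + l\<^sup>2"
    unfolding M l by (simp add: power2_eq_square algebra_simps)
  have "g - m *\<^sub>R q = \<psi> - k\<^sup>2 *\<^sub>R q" "g - M *\<^sub>R q = \<psi> - l\<^sup>2 *\<^sub>R q"
    unfolding M' \<psi>_def by (simp_all add: algebra_simps)
  with sector have S: "(\<psi> - k\<^sup>2 *\<^sub>R q) \<bullet> (\<psi> - l\<^sup>2 *\<^sub>R q) \<le> 0"
    by simp
  have l': "l = k + 2 * a"
    by (simp add: l a_def)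
  define w where "w = (2 * a) *\<^sub>R y + \<psi> - (k * l) *\<^sub>R q"
  \<comment> \<open>The \<open>q \<bullet> \<psi>\<close> terms match because \<open>2 k l -
    k\<^sup>2 - l\<^sup>2 = - (l - k)\<^sup>2 = - 4 a\<^sup>2\<close>; this is what fixes
    \<open>l = k + 2 a\<close>.\<close>
  have "2 * a * ?D = - (w \<bullet> w) + (\<psi> - k\<^sup>2 *\<^sub>R q) \<bullet> (\<psi> - l\<^sup>2 *\<^sub>R q)"
    unfolding D w_def l'
    by (simp add: inner_add inner_diff inner_commute algebra_simps power2_eq_square)
  then have "2 * a * ?D \<le> 0"
    using S inner_ge_zero[of w] by linarith
  then show ?thesis
    using assms(1) by (simp add: a_def mult_le_0_iff)
qed

text \<open>The form is the squared Euclidean norm of the pair \<open>p + \<sigma> q\<close>,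
  \<open>sqrt b q\<close>, so the triangle inequality gives one half of the equivalence with the
  norm of the state.\<close>

lemma lyapunov_upper:
  fixes q p :: "'a::real_inner"
  assumes "\<sigma> \<ge> 0" "b > 0"
  shows "sqrt (lyapunov \<sigma> b q p) \<le> (1 + \<sigma> + sqrt b) * norm (q, p)"
proof -
  have "lyapunov \<sigma> b q p = (norm (p + \<sigma> *\<^sub>R q))\<^sup>2 + (sqrt b * norm q)\<^sup>2"
    using assms by (simp add: lyapunov_def power_mult_distrib power2_norm_eq_inner)
  then have "sqrt (lyapunov \<sigma> b q p) \<le> norm (p + \<sigma> *\<^sub>R q) + sqrt b * norm q"
    using sqrt_sum_squares_le_sum[of "norm (p + \<sigma> *\<^sub>R q)" "sqrt b * norm q"] assms by simp
  also have "norm (p + \<sigma> *\<^sub>R q) \<le> norm p + \<sigma> * norm q"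
    using norm_triangle_ineq[of p "\<sigma> *\<^sub>R q"] assms by simp
  also have "norm p + \<sigma> * norm q + sqrt b * norm q
      \<le> norm (q, p) + \<sigma> * norm (q, p) + sqrt b * norm (q, p)"
    using assms norm_fst_le[of q p] norm_snd_le[of p q]
    by (intro add_mono mult_left_mono) auto
  finally show ?thesis
    by (simp add: algebra_simps)
qed

text \<open>The other half: each component of that pair is at most the square root of the form, and
  \<open>p\<close> is recovered as \<open>(p + \<sigma> q) - \<sigma> q\<close>.\<close>

lemma lyapunov_lower:
  fixes q p :: "'a::real_inner"
  assumes "\<sigma> \<ge> 0" "b > 0"
  shows "norm (q, p) \<le> (1 + (1 + \<sigma>) / sqrt b) * sqrt (lyapunov \<sigma> b q p)"
proof -
  let ?s = "sqrt (lyapunov \<sigma> b q p)"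
  have V: "lyapunov \<sigma> b q p = (norm (p + \<sigma> *\<^sub>R q))\<^sup>2 + (sqrt b * norm q)\<^sup>2"
    using assms by (simp add: lyapunov_def power_mult_distrib power2_norm_eq_inner)
  have 1: "norm (p + \<sigma> *\<^sub>R q) \<le> ?s"
    unfolding V by (rule real_sqrt_sum_squares_ge1)
  have "sqrt b * norm q \<le> ?s"
    unfolding V by (rule real_sqrt_sum_squares_ge2)
  then have 2: "norm q \<le> ?s / sqrt b"
    using assms by (simp add: field_simps)
  have "norm p \<le> norm (p + \<sigma> *\<^sub>R q) + norm (\<sigma> *\<^sub>R q)"
    using norm_triangle_ineq4[of "p + \<sigma> *\<^sub>R q" "\<sigma> *\<^sub>R q"] by simp
  then have "norm p \<le> norm (p + \<sigma> *\<^sub>R q) + \<sigma> * norm q"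
    using assms by simp
  moreover have "\<sigma> * norm q \<le> \<sigma> * (?s / sqrt b)"
    using 2 assms by (intro mult_left_mono) auto
  moreover have "norm (q, p) \<le> norm q + norm p"
    by (rule norm_Pair_le)
  ultimately have "norm (q, p) \<le> ?s / sqrt b + (?s + \<sigma> * (?s / sqrt b))"
    using 1 2 by linarith
  then show ?thesis
    by (simp add: algebra_simps add_divide_distrib)
qed

text \<open>Derivatives within \<open>I\<close> may be one-sided at end points. There only
  continuity is used; strictly between \<open>s\<close> and \<open>t\<close> the points are interior
  and the derivative is two-sided.\<close>

lemma interval_nonincreasing:
  fixes W W' :: "real \<Rightarrow> real"
  assumes I: "is_interval I" "s \<in> I" "t \<in> I" "s \<le> t"
    and deriv: "\<And>u. u \<in> I \<Longrightarrow> (W has_real_derivative W' u) (at u within I)"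
    and nonpos: "\<And>u. u \<in> I \<Longrightarrow> W' u \<le> 0"
  shows "W t \<le> W s"
proof (rule DERIV_nonpos_imp_decreasing_open[OF \<open>s \<le> t\<close>])
  have sub: "{s..t} \<subseteq> I"
    using mem_is_interval_1_I[OF I(1-3)] by auto
  show "continuous_on {s..t} W"
    using DERIV_continuous_on[OF deriv] sub by (rule continuous_on_subset)
  fix u assume u: "s < u" "u < t"
  then have "u \<in> interior I"
    using interiorI[OF open_greaterThanLessThan, of u s t I] sub
      greaterThanLessThan_subseteq_atLeastAtMost_iff[of s t s t]
    by auto
  moreover have "u \<in> I"
    using u sub by auto
  ultimately show "\<exists>D. DERIV W u :> D \<and> D \<le> 0"
    using deriv[of u] nonpos[of u] at_within_interior[of u I] by metis
qed

text \<open>The force \<open>G\<close> enters only through the dissipation inequality. That makes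
  the weighted form \<open>W\<close> nonincreasing, and comparing it with the norm at times
  \<open>t\<close> and \<open>0\<close> produces the two constant factors.\<close>

lemma damped_solution_decay:
  fixes G :: "real \<Rightarrow> 'a::euclidean_space \<Rightarrow> 'a"
  assumes sol: "solution_on (\<lambda>t (q, p). (p, - (2 * \<sigma>) *\<^sub>R p - G t q)) I z"
    and t: "t \<in> I"
    and "b > 0" "\<sigma> \<ge> 0"
    and dissipation: "\<And>u q p. u \<ge> 0 \<Longrightarrow> 2 * r * lyapunov \<sigma> b q p
      + 2 * ((p + \<sigma> *\<^sub>R q) \<bullet> (- \<sigma> *\<^sub>R p - G u q)) + 2 * b * (q \<bullet> p) \<le> 0"
  shows "norm (z t) \<le> (1 + (1 + \<sigma>) / sqrt b) * (1 + \<sigma> + sqrt b) * norm (z 0) * exp (- r * t)"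
proof -
  define q where "q u = fst (z u)" for u
  define p where "p u = snd (z u)" for u
  have z: "z u = (q u, p u)" for u
    by (simp add: q_def p_def)
  have I: "is_interval I" "0 \<in> I" "I \<subseteq> {0..}"
    and dz: "\<And>u. u \<in> I \<Longrightarrow>
      (z has_vector_derivative (p u, - (2 * \<sigma>) *\<^sub>R p u - G u (q u))) (at u within I)"
    using sol by (auto simp: solution_on_def z)
  have dq: "(q has_vector_derivative p u) (at u within I)" if "u \<in> I" for u
    using bounded_linear.has_vector_derivative[OF bounded_linear_fst dz[OF that]]
    by (simp add: q_def[abs_def])
  have dp: "(p has_vector_derivative - (2 * \<sigma>) *\<^sub>R p u - G u (q u)) (at u within I)"
    if "u \<in> I" for u
    using bounded_linear.has_vector_derivative[OF bounded_linear_snd dz[OF that]]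
    by (simp add: p_def[abs_def])
  define V where "V u = lyapunov \<sigma> b (q u) (p u)" for u
  define W where "W u = exp (2 * r * u) * V u" for u
  \<comment> \<open>Chosen so that \<open>V' = D - 2 r V\<close>, hence
    \<open>W' = exp (2 r u) D\<close>, while \<open>D\<close> is exactly the quantity bounded by
    \<open>dissipation\<close>.\<close>
  define D where "D u = 2 * r * V u
      + 2 * ((p u + \<sigma> *\<^sub>R q u) \<bullet> (- \<sigma> *\<^sub>R p u - G u (q u))) + 2 * b * (q u \<bullet> p u)" for u
  have "W t \<le> W 0"
  proof (rule interval_nonincreasing[OF I(1,2) t])
    show "0 \<le> t"
      using I t by auto
    fix u assume u: "u \<in> I"
    have inner: "((\<lambda>u. x u \<bullet> y u) has_vector_derivative x u \<bullet> y' + x' \<bullet> y u) (at u within I)"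
      if "(x has_vector_derivative x') (at u within I)"
        and "(y has_vector_derivative y') (at u within I)" for x y :: "real \<Rightarrow> 'a" and x' y'
      using bounded_bilinear.has_vector_derivative[OF bounded_bilinear_inner that] .
    have "((\<lambda>u. p u + \<sigma> *\<^sub>R q u) has_vector_derivative
        (- (2 * \<sigma>) *\<^sub>R p u - G u (q u)) + \<sigma> *\<^sub>R p u) (at u within I)"
      using dq[OF u] dp[OF u]
      by (intro has_vector_derivative_add bounded_linear.has_vector_derivative
          [OF bounded_linear_scaleR_right])
    then have dy: "((\<lambda>u. p u + \<sigma> *\<^sub>R q u) has_vector_derivative
        - \<sigma> *\<^sub>R p u - G u (q u)) (at u within I)"
      by (rule has_vector_derivative_eq_rhs) (simp add: algebra_simps flip: scaleR_2)
    have dV: "(V has_real_derivative D u - 2 * r * V u) (at u within I)"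
      using DERIV_add[OF inner[OF dy dy, folded has_real_derivative_iff_has_vector_derivative]
          DERIV_cmult[OF inner[OF dq dq, OF u u,
            folded has_real_derivative_iff_has_vector_derivative], of b]]
      unfolding V_def[abs_def] lyapunov_def D_def
      by (rule DERIV_cong) (simp add: inner_commute)
    show "(W has_real_derivative exp (2 * r * u) * D u) (at u within I)"
      unfolding W_def[abs_def]
      by (rule derivative_eq_intros dV refl)+ (simp add: algebra_simps)
    show "exp (2 * r * u) * D u \<le> 0"
      using dissipation[of u "q u" "p u"] u I
      by (auto simp: D_def V_def mult_le_0_iff)
  qed
  then have "exp (2 * r * t) * V t \<le> V 0"
    by (simp add: W_def)
  then have "sqrt (exp (2 * r * t) * V t) \<le> sqrt (V 0)"
    by simp
  moreover have "sqrt (exp (2 * r * t)) = exp (r * t)"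
    by (rule real_sqrt_unique) (simp_all add: power2_eq_square flip: exp_add)
  ultimately have "exp (r * t) * sqrt (V t) \<le> sqrt (V 0)"
    by (simp add: real_sqrt_mult)
  then have "sqrt (V t) \<le> sqrt (V 0) * exp (- r * t)"
    by (simp add: exp_minus field_simps)
  also have "sqrt (V 0) \<le> (1 + \<sigma> + sqrt b) * norm (z 0)"
    using lyapunov_upper[OF \<open>\<sigma> \<ge> 0\<close> \<open>b > 0\<close>] by (simp add: V_def z)
  finally have *: "sqrt (V t) \<le> (1 + \<sigma> + sqrt b) * norm (z 0) * exp (- r * t)"
    by simp
  have "norm (z t) \<le> (1 + (1 + \<sigma>) / sqrt b) * sqrt (V t)"
    using lyapunov_lower[OF \<open>\<sigma> \<ge> 0\<close> \<open>b > 0\<close>] by (simp add: V_def z)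
  also have "\<dots> \<le> (1 + (1 + \<sigma>) / sqrt b) * ((1 + \<sigma> + sqrt b) * norm (z 0) * exp (- r * t))"
    using * assms by (intro mult_left_mono) auto
  finally show ?thesis
    by (simp add: mult.assoc)
qed

theorem theorem4:
  fixes f :: "real \<Rightarrow> real ^ 'd \<Rightarrow> real"
    and m L \<sigma> r :: real
  assumes "\<And>t. t \<ge> 0 \<Longrightarrow> C1_function (f t)"
    and "continuous_on ({0..} \<times> UNIV) (\<lambda>(t, q). gradient (f t) q)"
    and "m > 0" "\<sigma> > 0" "r > 0" "L > m"
    and "r < \<sigma>"
    and "m \<ge> 2 * r * \<sigma> - r\<^sup>2"
    and "L \<le> m + 4 * (\<sigma> - r) * (\<sigma> - r + sqrt (m - 2 * r * \<sigma> + r\<^sup>2))"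
    and "\<And>t. t \<ge> 0 \<Longrightarrow> in_sector m L (gradient (f t))"
  shows "exponentially_stable r
           (\<lambda>t (q, p). (p, - (2 * \<sigma>) *\<^sub>R p - gradient (f t) q))"
proof -
  define k where "k = sqrt (m - 2 * r * \<sigma> + r\<^sup>2)"
  define l where "l = k + 2 * (\<sigma> - r)"
  define b where "b = (\<sigma> - r)\<^sup>2 + k * l"
  define M where "M = m + 4 * (\<sigma> - r) * (\<sigma> - r + k)"
  define K where "K = (1 + (1 + \<sigma>) / sqrt b) * (1 + \<sigma> + sqrt b)"
  have k: "k \<ge> 0" "k\<^sup>2 = m - 2 * r * \<sigma> + r\<^sup>2"
    using assms(8) by (simp_all add: k_def)
  have "0 \<le> k * l"
    using k assms(7) by (simp add: l_def)
  \<comment> \<open>Since \<open>k = 0\<close> is allowed, strict positivity has to come from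
    \<open>(\<sigma> - r)\<^sup>2\<close>.\<close>
  then have b: "b > 0"
    unfolding b_def using assms(7) by (intro add_pos_nonneg) auto
  have K: "K > 0"
    unfolding K_def using b assms(4) by (intro mult_pos_pos add_pos_nonneg) auto
  have dissipation: "2 * r * lyapunov \<sigma> b q p
      + 2 * ((p + \<sigma> *\<^sub>R q) \<bullet> (- \<sigma> *\<^sub>R p - gradient (f t) q)) + 2 * b * (q \<bullet> p) \<le> 0"
    if "t \<ge> 0" for t and q p :: "real ^ 'd"
  proof (rule lyapunov_dissipation[OF assms(7) k(2) l_def b_def M_def])
    have "(gradient (f t) q - m *\<^sub>R q) \<bullet> (gradient (f t) q - L *\<^sub>R q) \<le> 0"
      using assms(3,6) by (intro in_sectorD assms(10) that) auto
    moreover have "L \<le> M"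
      using assms(9) by (simp add: M_def k_def)
    ultimately show "(gradient (f t) q - m *\<^sub>R q) \<bullet> (gradient (f t) q - M *\<^sub>R q) \<le> 0"
      using assms(6) sector_upper_mono by blast
  qed
  \<comment> \<open>Joint continuity in \<open>(t, q)\<close> is pulled back along the projection
    from \<open>(t, (q, p))\<close>.\<close>
  have "continuous_on ({0..} \<times> UNIV)
      ((\<lambda>(t, q). gradient (f t) q) \<circ> (\<lambda>x::real \<times> (real ^ 'd) \<times> (real ^ 'd). (fst x, fst (snd x))))"
    by (intro continuous_on_compose continuous_intros
        continuous_on_subset[OF assms(2)]) auto
  then have grad: "continuous_on ({0..} \<times> UNIV)
      (\<lambda>x::real \<times> (real ^ 'd) \<times> (real ^ 'd). gradient (f (fst x)) (fst (snd x)))"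
    by (simp add: o_def)
  show ?thesis
    unfolding exponentially_stable_def
  \<comment> \<open>A linear \<open>\<kappa>\<close> suffices, as the decay estimate is proportional
    to \<open>norm (z 0)\<close>.\<close>
  proof (intro conjI exI[of _ "\<lambda>s. K * s"] allI impI ballI)
    show "continuous_on ({0..} \<times> UNIV)
       (\<lambda>(t, z). case z of (q, p) \<Rightarrow> (p, - (2 * \<sigma>) *\<^sub>R p - gradient (f t) q))"
      unfolding case_prod_unfold by (intro continuous_intros grad)
    show "(case 0 of (q, p) \<Rightarrow> (p, - (2 * \<sigma>) *\<^sub>R p - gradient (f t) q)) = 0" if "t \<ge> 0" for t
      using in_sector_zero[OF assms(10)[OF that]] assms(3,6) by (simp add: zero_prod_def)
    show "strict_mono_on {0..} (\<lambda>s. K * s)"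
      using K by (auto simp: strict_mono_on_def)
    show "norm (z t) \<le> K * norm (z 0) * exp (- r * t)"
      if "solution_on (\<lambda>t (q, p). (p, - (2 * \<sigma>) *\<^sub>R p - gradient (f t) q)) I z" "t \<in> I" for I z t
      unfolding K_def using damped_solution_decay[OF that b _ dissipation] assms(4) by simp
  qed (use K in \<open>auto intro!: continuous_intros\<close>)
qed

end
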